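(* Let $a>b>0$ be real, let $\mathcal{E}\subset\mathbb{CP}^2$ be the complex conic $\frac{x^2}{a^2}+\frac{y^2}{b^2}=1$, and for $\lambda\in\mathbb{C}\setminus\{-a^2,-b^2\}$ let $\mathcal{C}_\lambda$ be the complex conic $\frac{x^2}{a^2+\lambda}+\frac{y^2}{b^2+\lambda}=1$. Let $T=(M_0,\ldots,M_n)$ be an $(n+1)$-tuple of points of $\mathcal{E}$ such that any two consecutive points are distinct. The following statements are equivalent: (i) there is a $\lambda$ with $a^2+\lambda\neq 0$ and $b^2+\lambda\neq0$ such that for each $j\in\{1,\ldots,n-1\}$ the lines $M_{j-1}M_j$ and $M_jM_{j+1}$ realize the two tangent lines to $\mathcal{C}_\lambda$ going through $M_j$; (ii) $T$ is a non-degenerate, non-isotropic piece of complex billiard trajectory on $\mathcal{E}$ whose sides contain neither the real nor the complex foci of $\mathcal{E}$. If this $\lambda$ exists, then it is unique.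
   Context: Conics are considered in $\mathbb{CP}^2=\mathbb{C}^2\sqcup\overline{\mathbb{C}}_\infty$, where $\overline{\mathbb{C}}_\infty$ is the line at infinity; $\mathcal{E}$ and $\mathcal{C}_\lambda$ denote the projective closures. "The two tangent lines to $\mathcal{C}_\lambda$ through $M$" are counted with multiplicity: if $M\in\mathcal{C}_\lambda$ they coincide (both equal the tangent line at $M$); if $M\notin\mathcal{C}_\lambda$ they are two distinct lines, so the two sides must then be these two distinct lines. Let $q(x,y)=x^2+y^2$ on $\mathbb{C}^2$. A line in $\mathbb{CP}^2$ is isotropic if it contains $I=(1:i:0)$ or $J=(1:-i:0)$ (so the line at infinity is isotropic), and non-isotropic otherwise. The symmetry with respect to a non-isotropic line $L$ is the unique non-trivial complex affine involution of $\mathbb{C}^2$ that is isometric for $q$ and fixes $L$ pointwise, extended to $\mathbb{CP}^2$; it acts on points and on lines. A non-degenerate piece of complex billiard trajectory on $\mathcal{E}$ is an ordered tuple $(M_0,\ldots,M_n)$ of points of $\mathcal{E}$ with $M_j\ne M_{j+1}$ for $0\le j\le n-1$, such that for all $1\le j\le n-1$ the tangent line $T_{M_j}\mathcal{E}$ is non-isotropic and the lines $M_{j-1}M_j$ and $M_jM_{j+1}$ are symmetric with respect to $T_{M_j}\mathcal{E}$. Its sides are the lines $M_jM_{j+1}$. It is non-isotropic if none of its sides is isotropic. With $c=\sqrt{a^2-b^2}$, the real foci of $\mathcal{E}$ are $(\pm c,0)$ and the complex foci are $(0,\pm ic)$.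
   Formalization: The formal theorem assumes n ≥ 2: for n ≤ 1 condition (i) is vacuous, so every admissible λ satisfies it and uniqueness fails; for n = 1 the equivalence also fails, e.g. when the line M_0M_1 passes through a focus. *)

theory Defs
  imports "HOL-Analysis.Analysis"
begin

section \<open>The complex projective plane\<close>

definition proportional :: "complex^3 \<Rightarrow> complex^3 \<Rightarrow> bool" where
  "proportional u v \<longleftrightarrow> u \<noteq> 0 \<and> v \<noteq> 0 \<and> (\<exists>k. k \<noteq> 0 \<and> v = k *s u)"

lemma part_equivp_proportional: "part_equivp proportional"
proof (rule part_equivpI)
  show "\<exists>x. proportional x x"
    by (rule exI[of _ "axis 1 1"], auto simp: proportional_def intro!: exI[of _ 1])
  show "symp proportional"
  proof (rule sympI)
    fix u v assume "proportional u v"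
    then obtain k where k: "u \<noteq> 0" "v \<noteq> 0" "k \<noteq> 0" "v = k *s u"
      by (auto simp: proportional_def)
    then have "u = inverse k *s v" by (simp add: vec_eq_iff)
    with k show "proportional v u"
      unfolding proportional_def by (metis inverse_nonzero_iff_nonzero)
  qed
  show "transp proportional"
  proof (rule transpI)
    fix u v w assume "proportional u v" "proportional v w"
    then show "proportional u w"
      unfolding proportional_def by (metis mult_eq_0_iff vector_smult_assoc)
  qed
qed

quotient_type cp2 = "complex^3" / partial: proportional
  by (rule part_equivp_proportional)

text \<open>The term \<open>hpoint x y z\<close> denotes the point \<open>(x : y : z)\<close>; it is only meaningful
  for \<open>(x, y, z) \<noteq> 0\<close>. The line at infinity is \<open>z = 0\<close>.\<close>

definition hpoint :: "complex \<Rightarrow> complex \<Rightarrow> complex \<Rightarrow> cp2" where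
  "hpoint x y z = abs_cp2 (vector [x, y, z])"

definition affine_point :: "complex^2 \<Rightarrow> cp2" where
  "affine_point v = hpoint (v$1) (v$2) 1"

text \<open>Note that \<open>scalar_product\<close> is bilinear, not Hermitian.\<close>

lift_definition incident :: "cp2 \<Rightarrow> cp2 \<Rightarrow> bool" is "\<lambda>l p. scalar_product l p = 0"
  by (auto simp: proportional_def scalar_product_def mult.assoc mult.left_commute
      simp flip: sum_distrib_left)

text \<open>A line is a set of points; its equation is a non-zero linear form up to scaling, that is,
  a point of the dual plane, which is represented here by the same type.\<close>

definition is_line :: "cp2 set \<Rightarrow> bool" where
  "is_line L \<longleftrightarrow> (\<exists>l. L = {p. incident l p})"

definition line_through :: "cp2 \<Rightarrow> cp2 \<Rightarrow> cp2 set" where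
  "line_through P Q = (THE L. is_line L \<and> P \<in> L \<and> Q \<in> L)"


section \<open>Conics and their tangent lines\<close>

text \<open>A conic is given by the symmetric matrix \<open>S\<close> of its homogeneous equation
  \<open>p\<^sup>T S p = 0\<close>. The gradient of this equation at \<open>p\<close> is \<open>2 S p\<close>, so if the matrix is
  invertible then the tangent line at a point \<open>P\<close> of the conic is the set of points conjugate
  to \<open>P\<close>.\<close>

lift_definition conjugate :: "complex^3^3 \<Rightarrow> cp2 \<Rightarrow> cp2 \<Rightarrow> bool" is
  "\<lambda>S p r. scalar_product (S *v p) r = 0"
  by (auto simp: proportional_def scalar_product_def mult.assoc mult.left_commute vector_scalar_commute
      simp flip: sum_distrib_left)

definition conic_points :: "complex^3^3 \<Rightarrow> cp2 set" where
  "conic_points S = {P. conjugate S P P}"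

definition tangent_line :: "complex^3^3 \<Rightarrow> cp2 \<Rightarrow> cp2 set" where
  "tangent_line S P = {R. conjugate S P R}"

text \<open>The projective closure of \<open>x\<^sup>2 / A + y\<^sup>2 / B = 1\<close>.\<close>

definition central_conic :: "complex \<Rightarrow> complex \<Rightarrow> complex^3^3" where
  "central_conic A B = vector [vector [1 / A, 0, 0], vector [0, 1 / B, 0], vector [0, 0, -1]]"

definition ellipse :: "real \<Rightarrow> real \<Rightarrow> complex^3^3" where
  "ellipse a b = central_conic ((of_real a)\<^sup>2) ((of_real b)\<^sup>2)"

definition confocal :: "real \<Rightarrow> real \<Rightarrow> complex \<Rightarrow> complex^3^3" where
  "confocal a b l = central_conic ((of_real a)\<^sup>2 + l) ((of_real b)\<^sup>2 + l)"

definition tangents_through :: "complex^3^3 \<Rightarrow> cp2 \<Rightarrow> cp2 set set" where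
  "tangents_through S M = {L. \<exists>P\<in>conic_points S. L = tangent_line S P \<and> M \<in> L}"

text \<open>\<open>L1\<close> and \<open>L2\<close> are the two tangent lines through \<open>M\<close>, counted with multiplicity.\<close>

definition realize_tangents :: "complex^3^3 \<Rightarrow> cp2 \<Rightarrow> cp2 set \<Rightarrow> cp2 set \<Rightarrow> bool" where
  "realize_tangents S M L1 L2 \<longleftrightarrow>
     (if M \<in> conic_points S then L1 = tangent_line S M \<and> L2 = tangent_line S M
      else L1 \<noteq> L2 \<and> {L1, L2} = tangents_through S M)"

definition foci :: "real \<Rightarrow> real \<Rightarrow> cp2 set" where
  "foci a b = (let c = of_real (sqrt (a\<^sup>2 - b\<^sup>2)) in
     {hpoint c 0 1, hpoint (- c) 0 1, hpoint 0 (\<i> * c) 1, hpoint 0 (- \<i> * c) 1})"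


section \<open>Complex reflection\<close>

definition q :: "complex^2 \<Rightarrow> complex" where
  "q v = (v$1)\<^sup>2 + (v$2)\<^sup>2"

definition isotropic :: "cp2 set \<Rightarrow> bool" where
  "isotropic L \<longleftrightarrow> hpoint 1 \<i> 0 \<in> L \<or> hpoint 1 (- \<i>) 0 \<in> L"

definition affine_map :: "complex^2^2 \<Rightarrow> complex^2 \<Rightarrow> complex^2 \<Rightarrow> complex^2" where
  "affine_map A t v = A *v v + t"

text \<open>The projective extension, given by the block matrix with rows \<open>(A t)\<close> and \<open>(0 1)\<close>.
  It does not depend on the representative if \<open>A\<close> is invertible.\<close>

definition affine_extension :: "complex^2^2 \<Rightarrow> complex^2 \<Rightarrow> cp2 \<Rightarrow> cp2" where
  "affine_extension A t p = abs_cp2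
     (vector [vector [A$1$1, A$1$2, t$1], vector [A$2$1, A$2$2, t$2], vector [0, 0, 1]]
        *v rep_cp2 p)"

definition affine_symmetry :: "cp2 set \<Rightarrow> (complex^2 \<Rightarrow> complex^2) \<Rightarrow> bool" where
  "affine_symmetry L f \<longleftrightarrow>
     f \<noteq> id \<and> f \<circ> f = id \<and> (\<forall>u v. q (f u - f v) = q (u - v)) \<and>
     (\<forall>v. affine_point v \<in> L \<longrightarrow> f v = v)"

definition symmetry :: "cp2 set \<Rightarrow> cp2 \<Rightarrow> cp2" where
  "symmetry L = (THE s. \<exists>A t. affine_symmetry L (affine_map A t) \<and> s = affine_extension A t)"

definition symmetric_lines :: "cp2 set \<Rightarrow> cp2 set \<Rightarrow> cp2 set \<Rightarrow> bool" where
  "symmetric_lines L L1 L2 \<longleftrightarrow> symmetry L ` L1 = L2"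


section \<open>Billiard trajectories\<close>

text \<open>A tuple \<open>(M\<^sub>0, \<dots>, M\<^sub>n)\<close> is a function on \<open>nat\<close> of which only the values at \<open>j \<le> n\<close>
  matter.\<close>

definition side :: "(nat \<Rightarrow> cp2) \<Rightarrow> nat \<Rightarrow> cp2 set" where
  "side M j = line_through (M j) (M (Suc j))"

definition billiard_piece :: "complex^3^3 \<Rightarrow> nat \<Rightarrow> (nat \<Rightarrow> cp2) \<Rightarrow> bool" where
  "billiard_piece S n M \<longleftrightarrow>
     (\<forall>j\<le>n. M j \<in> conic_points S) \<and> (\<forall>j<n. M j \<noteq> M (Suc j)) \<and>
     (\<forall>j\<in>{1..<n}. \<not> isotropic (tangent_line S (M j)) \<and>
        symmetric_lines (tangent_line S (M j)) (side M (j - 1)) (side M j))"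

definition non_isotropic_piece :: "nat \<Rightarrow> (nat \<Rightarrow> cp2) \<Rightarrow> bool" where
  "non_isotropic_piece n M \<longleftrightarrow> (\<forall>j<n. \<not> isotropic (side M j))"

definition sides_tangent :: "complex^3^3 \<Rightarrow> nat \<Rightarrow> (nat \<Rightarrow> cp2) \<Rightarrow> bool" where
  "sides_tangent S n M \<longleftrightarrow>
     (\<forall>j\<in>{1..<n}. realize_tangents S (M j) (side M (j - 1)) (side M j))"

end

theory Submission
  imports Defs
begin

text \<open>Write a line as a covector \<open>l\<close>, and put \<open>A = a\<^sup>2\<close>, \<open>B = b\<^sup>2\<close>,
  \<open>F l = A l\<^sub>1\<^sup>2 + B l\<^sub>2\<^sup>2 - l\<^sub>3\<^sup>2\<close> and \<open>G l = l\<^sub>1\<^sup>2 + l\<^sub>2\<^sup>2\<close>. The line is tangent to the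
  confocal conic with parameter \<open>\<lambda>\<close> iff \<open>F l + \<lambda> G l = 0\<close>, it is isotropic iff \<open>G l = 0\<close>, and it contains a
  focus iff \<open>F l = A G l\<close> or \<open>F l = B G l\<close>. A side meets the ellipse in two distinct points, so
  \<open>F l \<noteq> 0\<close>; hence a non-isotropic side avoiding the foci touches exactly one confocal conic, the one with
  \<open>\<lambda> = - F l / G l\<close>.

  Let \<open>t\<close> be the tangent line to the ellipse at a vertex. Then \<open>F\<close> vanishes at \<open>t\<close> and \<open>t\<close> is
  \<open>F\<close>-orthogonal to every line through the vertex, so the \<open>G\<close>-reflection in \<open>t\<close> preserves
  both \<open>F\<close> and \<open>G\<close> on the pencil at the vertex. On this pencil, spanned by \<open>l\<close> and \<open>t\<close>, the
  form \<open>F + \<lambda> G\<close> vanishing at \<open>l\<close> has exactly one further zero, counted with multiplicity: the reflected line if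
  \<open>G t \<noteq> 0\<close>, and \<open>t\<close> itself, which is not a side, if \<open>G t = 0\<close>.\<close>

section \<open>Points and lines in coordinates\<close>

lemma proportional_refl: "proportional v v \<longleftrightarrow> v \<noteq> 0"
  by (auto simp: proportional_def intro!: exI[of _ 1])

lemma proportional_sym: "proportional u v \<Longrightarrow> proportional v u"
  by (rule part_equivp_symp[OF part_equivp_proportional])

lemma proportional_trans: "proportional u v \<Longrightarrow> proportional v w \<Longrightarrow> proportional u w"
  by (rule part_equivp_transp[OF part_equivp_proportional])

lemma scalar_product_3: "scalar_product (u :: complex^3) v = u$1 * v$1 + u$2 * v$2 + u$3 * v$3"
  by (simp add: scalar_product_def sum_3)

lemma eq_0_iff_3: "(v :: complex^3) = 0 \<longleftrightarrow> v$1 = 0 \<and> v$2 = 0 \<and> v$3 = 0"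
  by (simp add: vec_eq_iff forall_3)

text \<open>The cross product: the join of two points and, dually, the common point of two
  lines.\<close>

definition wedge :: "complex^3 \<Rightarrow> complex^3 \<Rightarrow> complex^3" where
  "wedge u v = vector [u$2 * v$3 - u$3 * v$2, u$3 * v$1 - u$1 * v$3, u$1 * v$2 - u$2 * v$1]"

lemma scalar_product_wedge [simp]:
  "scalar_product (wedge u v) u = 0" "scalar_product (wedge u v) v = 0"
  by (simp_all add: scalar_product_3 wedge_def algebra_simps)

lemma proportional_iff_wedge:
  assumes "u \<noteq> 0" "v \<noteq> 0"
  shows "proportional u v \<longleftrightarrow> wedge u v = 0"
proof
  assume "proportional u v"
  then show "wedge u v = 0"
    by (auto simp: proportional_def wedge_def eq_0_iff_3)
next
  assume "wedge u v = 0"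
  then have eq: "u$1 * v$2 = u$2 * v$1 \<and> u$1 * v$3 = u$3 * v$1 \<and> u$2 * v$3 = u$3 * v$2"
    by (simp add: wedge_def eq_0_iff_3)
  have "\<exists>k. v = k *s u"
  proof -
    consider "u$1 \<noteq> 0" | "u$2 \<noteq> 0" | "u$3 \<noteq> 0"
      using assms(1) by (auto simp: eq_0_iff_3)
    then show ?thesis
    proof cases
      case 1
      with eq show ?thesis
        by (intro exI[of _ "v$1 / u$1"]) (simp add: vec_eq_iff forall_3 field_simps)
    next
      case 2
      with eq show ?thesis
        by (intro exI[of _ "v$2 / u$2"]) (simp add: vec_eq_iff forall_3 field_simps)
    next
      case 3
      with eq show ?thesis
        by (intro exI[of _ "v$3 / u$3"]) (simp add: vec_eq_iff forall_3 field_simps)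
    qed
  qed
  with assms show "proportional u v"
    by (auto simp: proportional_def)
qed

text \<open>The double cross product \<open>u x (p x r)\<close> expands to
  \<open>(u . r) p - (u . p) r\<close>.\<close>

lemma wedge_eq_0_if_orthogonal:
  assumes "scalar_product u p = 0" "scalar_product u r = 0"
  shows "wedge u (wedge p r) = 0"
  using assms unfolding scalar_product_3 wedge_def eq_0_iff_3
  by (simp del: right_minus_eq) (intro conjI; algebra)

text \<open>Both vectors are multiples of the cross product of \<open>p\<close> and
  \<open>r\<close>. Read with the roles of points and lines exchanged, it also says that two
  distinct lines meet in one point.\<close>

lemma annihilator_unique:
  assumes "u \<noteq> 0" "v \<noteq> 0" "p \<noteq> 0" "r \<noteq> 0" "\<not> proportional p r"
    and "scalar_product u p = 0" "scalar_product u r = 0"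
    and "scalar_product v p = 0" "scalar_product v r = 0"
  shows "proportional u v"
proof -
  have w: "wedge p r \<noteq> 0"
    using assms(3-5) by (simp add: proportional_iff_wedge)
  have "proportional u (wedge p r)" "proportional v (wedge p r)"
    using assms w by (simp_all add: proportional_iff_wedge wedge_eq_0_if_orthogonal)
  then show ?thesis
    by (blast intro: proportional_sym proportional_trans)
qed

text \<open>Both \<open>l\<close> and \<open>t\<close> annihilate \<open>m\<close>, so
  \<open>wedge l t\<close> is a multiple of \<open>m\<close>. A further line \<open>k\<close>
  through \<open>m\<close> therefore has determinant zero with \<open>l\<close> and
  \<open>t\<close>, and Cramer's rule yields the coefficients.\<close>

lemma pencil_combination:
  assumes "m \<noteq> 0" "l \<noteq> 0" "t \<noteq> 0" "\<not> proportional l t"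
    and "scalar_product l m = 0" "scalar_product t m = 0" "scalar_product k m = 0"
  obtains x y where "k = x *s l + y *s t"
proof -
  let ?w = "wedge l t"
  have w: "?w \<noteq> 0"
    using assms by (simp add: proportional_iff_wedge)
  have "wedge m ?w = 0"
    using assms by (intro wedge_eq_0_if_orthogonal) (simp_all add: scalar_product_3 mult.commute)
  then have "proportional m ?w"
    using assms w by (simp add: proportional_iff_wedge)
  then obtain c where c: "?w = c *s m"
    by (auto simp: proportional_def)
  have "scalar_product k ?w = c * scalar_product k m"
    unfolding c by (simp add: scalar_product_3 algebra_simps)
  with assms(7) have kw: "scalar_product k ?w = 0"
    by simp
  have *: "\<exists>x y. k = x *s l + y *s t" if "?w $ i \<noteq> 0" for i
  proof (intro exI)
    show "k = (wedge k t $ i / ?w $ i) *s l + (wedge l k $ i / ?w $ i) *s t"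
    proof -
      \<comment> \<open>For \<open>i\<close> different from \<open>j\<close> this is an identity;
        for \<open>i = j\<close> the two sides differ by the determinant of \<open>k\<close>,
        \<open>l\<close>, \<open>t\<close>, which is zero by \<open>kw\<close>.\<close>
      have "?w $ i * k $ j = wedge k t $ i * l $ j + wedge l k $ i * t $ j" for j
      proof -
        have "\<forall>i j. ?w $ i * k $ j = wedge k t $ i * l $ j + wedge l k $ i * t $ j"
          using kw unfolding forall_3 scalar_product_3 wedge_def vector_3
          by - (intro conjI; (simp add: algebra_simps; fail | algebra))
        then show ?thesis by blast
      qed
      then show ?thesis
        using that by (simp add: vec_eq_iff field_simps)
    qed
  qed
  obtain i where "?w $ i \<noteq> 0"
    using w by (auto simp: vec_eq_iff)
  from *[OF this] that show ?thesis
    by blast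
qed

section \<open>Lines as sets of points of the projective plane\<close>

lemma cp2_cases:
  obtains v where "v \<noteq> 0" "P = abs_cp2 v"
  by (induction P rule: cp2.abs_induct) (auto simp: proportional_refl)

lemma abs_cp2_eq_iff: "u \<noteq> 0 \<Longrightarrow> v \<noteq> 0 \<Longrightarrow> abs_cp2 u = abs_cp2 v \<longleftrightarrow> proportional u v"
  using Quotient3_rel[OF Quotient3_cp2, of u v] by (simp add: proportional_refl)

lemma incident_abs: "l \<noteq> 0 \<Longrightarrow> p \<noteq> 0 \<Longrightarrow> incident (abs_cp2 l) (abs_cp2 p) \<longleftrightarrow> scalar_product l p = 0"
  by (simp add: incident.abs_eq proportional_refl)

lemma conjugate_abs:
  "p \<noteq> 0 \<Longrightarrow> r \<noteq> 0 \<Longrightarrow> conjugate S (abs_cp2 p) (abs_cp2 r) \<longleftrightarrow> scalar_product (S *v p) r = 0"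
  by (simp add: conjugate.abs_eq proportional_refl)

definition line_of :: "complex^3 \<Rightarrow> cp2 set" where
  "line_of l = {P. incident (abs_cp2 l) P}"

lemma abs_in_line_of: "l \<noteq> 0 \<Longrightarrow> p \<noteq> 0 \<Longrightarrow> abs_cp2 p \<in> line_of l \<longleftrightarrow> scalar_product l p = 0"
  by (simp add: line_of_def incident_abs)

lemma is_line_iff: "is_line L \<longleftrightarrow> (\<exists>l. l \<noteq> 0 \<and> L = line_of l)"
  unfolding is_line_def line_of_def by (metis cp2_cases)

lemma line_of_eq_iff:
  assumes "l \<noteq> 0" "k \<noteq> 0"
  shows "line_of l = line_of k \<longleftrightarrow> proportional l k"
proof
  assume eq: "line_of l = line_of k"
  have *: "scalar_product k p = 0" if "scalar_product l p = 0" for p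
    using that eq assms by (cases "p = 0") (simp add: scalar_product_3, metis abs_in_line_of)
  \<comment> \<open>These points of \<open>l\<close> are its cross products with the unit vectors,
    up to sign. That \<open>k\<close> contains them says that every coordinate of
    \<open>wedge l k\<close> vanishes.\<close>
  have "scalar_product k (vector [0, l$3, - (l$2)]) = 0" "scalar_product k (vector [l$3, 0, - (l$1)]) = 0"
    "scalar_product k (vector [l$2, - (l$1), 0]) = 0"
    by (intro *, simp add: scalar_product_3)+
  with assms show "proportional l k"
    by (simp add: proportional_iff_wedge wedge_def eq_0_iff_3 scalar_product_3 algebra_simps)
next
  assume "proportional l k"
  with assms show "line_of l = line_of k"
    by (simp add: line_of_def flip: abs_cp2_eq_iff)
qed

lemma line_through_eq:
  assumes "p \<noteq> 0" "r \<noteq> 0" "\<not> proportional p r"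
  shows "line_through (abs_cp2 p) (abs_cp2 r) = line_of (wedge p r)"
  unfolding line_through_def
proof (rule the_equality)
  have w: "wedge p r \<noteq> 0"
    using assms by (simp add: proportional_iff_wedge)
  with assms show "is_line (line_of (wedge p r)) \<and> abs_cp2 p \<in> line_of (wedge p r) \<and>
      abs_cp2 r \<in> line_of (wedge p r)"
    by (auto simp: is_line_iff abs_in_line_of)
  fix L assume "is_line L \<and> abs_cp2 p \<in> L \<and> abs_cp2 r \<in> L"
  then obtain l where l: "l \<noteq> 0" "L = line_of l" "scalar_product l p = 0" "scalar_product l r = 0"
    using assms by (auto simp: is_line_iff abs_in_line_of)
  have "proportional l (wedge p r)"
    using assms w l by (intro annihilator_unique[of _ _ p r]) simp_all
  with w l show "L = line_of (wedge p r)"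
    by (simp add: line_of_eq_iff)
qed

section \<open>Dual conics\<close>

text \<open>The inverse matrix of \<open>central_conic \<alpha> \<beta>\<close>, for non-zero
  parameters. It is the equation of the dual conic and, unlike the conic itself, depends linearly on
  \<open>\<alpha>\<close> and \<open>\<beta>\<close>.\<close>

definition dual_form :: "complex \<Rightarrow> complex \<Rightarrow> complex^3 \<Rightarrow> complex^3 \<Rightarrow> complex" where
  "dual_form \<alpha> \<beta> k l = \<alpha> * k$1 * l$1 + \<beta> * k$2 * l$2 - k$3 * l$3"

definition polar_vec :: "complex \<Rightarrow> complex \<Rightarrow> complex^3 \<Rightarrow> complex^3" where
  "polar_vec \<alpha> \<beta> p = vector [p$1 / \<alpha>, p$2 / \<beta>, - (p$3)]"

definition pole_vec :: "complex \<Rightarrow> complex \<Rightarrow> complex^3 \<Rightarrow> complex^3" where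
  "pole_vec \<alpha> \<beta> l = vector [\<alpha> * l$1, \<beta> * l$2, - (l$3)]"

lemma central_conic_mult: "central_conic \<alpha> \<beta> *v p = polar_vec \<alpha> \<beta> p"
  by (simp add: vec_eq_iff forall_3 central_conic_def polar_vec_def matrix_vector_mult_def sum_3)

lemma polar_pole [simp]: "\<alpha> \<noteq> 0 \<Longrightarrow> \<beta> \<noteq> 0 \<Longrightarrow> polar_vec \<alpha> \<beta> (pole_vec \<alpha> \<beta> l) = l"
  and pole_polar [simp]: "\<alpha> \<noteq> 0 \<Longrightarrow> \<beta> \<noteq> 0 \<Longrightarrow> pole_vec \<alpha> \<beta> (polar_vec \<alpha> \<beta> l) = l"
  by (simp_all add: vec_eq_iff forall_3 pole_vec_def polar_vec_def)

lemma polar_eq_0_iff [simp]: "\<alpha> \<noteq> 0 \<Longrightarrow> \<beta> \<noteq> 0 \<Longrightarrow> polar_vec \<alpha> \<beta> p = 0 \<longleftrightarrow> p = 0"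
  and pole_eq_0_iff [simp]: "\<alpha> \<noteq> 0 \<Longrightarrow> \<beta> \<noteq> 0 \<Longrightarrow> pole_vec \<alpha> \<beta> l = 0 \<longleftrightarrow> l = 0"
  by (simp_all add: eq_0_iff_3 pole_vec_def polar_vec_def)

lemma dual_form_commute: "dual_form \<alpha> \<beta> k l = dual_form \<alpha> \<beta> l k"
  by (simp add: dual_form_def mult_ac)

lemma scalar_product_commute: "scalar_product (u :: complex^3) v = scalar_product v u"
  by (simp add: scalar_product_3 mult_ac)

lemma scalar_product_pole: "scalar_product (pole_vec \<alpha> \<beta> k) l = dual_form \<alpha> \<beta> k l"
  by (simp add: scalar_product_3 pole_vec_def dual_form_def)

lemma scalar_product_pole_right: "scalar_product k (pole_vec \<alpha> \<beta> l) = dual_form \<alpha> \<beta> k l"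
  by (simp add: scalar_product_3 pole_vec_def dual_form_def)

lemma dual_form_polar:
  "\<alpha> \<noteq> 0 \<Longrightarrow> \<beta> \<noteq> 0 \<Longrightarrow> dual_form \<alpha> \<beta> (polar_vec \<alpha> \<beta> p) l = scalar_product p l"
  by (simp flip: scalar_product_pole)

lemma polar_proportional_iff [simp]:
  assumes "\<alpha> \<noteq> 0" "\<beta> \<noteq> 0"
  shows "proportional (polar_vec \<alpha> \<beta> u) (polar_vec \<alpha> \<beta> v) \<longleftrightarrow> proportional u v"
proof -
  have "polar_vec \<alpha> \<beta> v = k *s polar_vec \<alpha> \<beta> u \<longleftrightarrow> v = k *s u" for k
    using assms by (simp add: polar_vec_def vec_eq_iff forall_3)
  with assms show ?thesis
    by (simp add: proportional_def)
qed

lemma abs_in_conic_points: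
  assumes "\<alpha> \<noteq> 0" "\<beta> \<noteq> 0" "p \<noteq> 0"
  shows "abs_cp2 p \<in> conic_points (central_conic \<alpha> \<beta>) \<longleftrightarrow> scalar_product (polar_vec \<alpha> \<beta> p) p = 0"
  using assms by (simp add: conic_points_def conjugate_abs central_conic_mult)

lemma tangent_line_eq:
  assumes "\<alpha> \<noteq> 0" "\<beta> \<noteq> 0" "p \<noteq> 0"
  shows "tangent_line (central_conic \<alpha> \<beta>) (abs_cp2 p) = line_of (polar_vec \<alpha> \<beta> p)"
proof (rule set_eqI)
  fix R
  obtain r where "r \<noteq> 0" "R = abs_cp2 r" by (rule cp2_cases)
  with assms show "R \<in> tangent_line (central_conic \<alpha> \<beta>) (abs_cp2 p) \<longleftrightarrow> R \<in> line_of (polar_vec \<alpha> \<beta> p)"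
    by (simp add: tangent_line_def conjugate_abs central_conic_mult abs_in_line_of)
qed

text \<open>A tangent line is the polar of its contact point, so the contact point is recovered as
  the pole of the line. Polarity turns the equation of the conic into that of the dual
  conic.\<close>

lemma tangents_through_eq:
  assumes "\<alpha> \<noteq> 0" "\<beta> \<noteq> 0" "m \<noteq> 0"
  shows "tangents_through (central_conic \<alpha> \<beta>) (abs_cp2 m) =
    line_of ` {k. k \<noteq> 0 \<and> scalar_product k m = 0 \<and> dual_form \<alpha> \<beta> k k = 0}"
proof (intro set_eqI iffI)
  fix L assume "L \<in> tangents_through (central_conic \<alpha> \<beta>) (abs_cp2 m)"
  then obtain P where P: "P \<in> conic_points (central_conic \<alpha> \<beta>)"
    "L = tangent_line (central_conic \<alpha> \<beta>) P" "abs_cp2 m \<in> L"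
    by (auto simp: tangents_through_def)
  obtain p where p: "p \<noteq> 0" "P = abs_cp2 p" by (rule cp2_cases)
  show "L \<in> line_of ` {k. k \<noteq> 0 \<and> scalar_product k m = 0 \<and> dual_form \<alpha> \<beta> k k = 0}"
    using P p assms
    by (intro image_eqI[of _ _ "polar_vec \<alpha> \<beta> p"])
       (auto simp: tangent_line_eq abs_in_conic_points abs_in_line_of dual_form_polar scalar_product_commute)
next
  fix L assume "L \<in> line_of ` {k. k \<noteq> 0 \<and> scalar_product k m = 0 \<and> dual_form \<alpha> \<beta> k k = 0}"
  then obtain k where k: "k \<noteq> 0" "scalar_product k m = 0" "dual_form \<alpha> \<beta> k k = 0" "L = line_of k"
    by blast
  with assms show "L \<in> tangents_through (central_conic \<alpha> \<beta>) (abs_cp2 m)"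
    unfolding tangents_through_def
    by (auto simp: tangent_line_eq abs_in_conic_points abs_in_line_of scalar_product_pole_right intro!: bexI[of _ "abs_cp2 (pole_vec \<alpha> \<beta> k)"])
qed

text \<open>A non-degenerate form in three variables has no totally isotropic plane: the poles of
  \<open>k\<close> and \<open>t\<close> would both be the common point of these two lines, hence
  equal.\<close>

lemma totally_isotropic_proportional:
  assumes "\<alpha> \<noteq> 0" "\<beta> \<noteq> 0" "k \<noteq> 0" "t \<noteq> 0"
    and "dual_form \<alpha> \<beta> k k = 0" "dual_form \<alpha> \<beta> t t = 0" "dual_form \<alpha> \<beta> k t = 0"
  shows "proportional k t"
proof (rule ccontr)
  assume "\<not> proportional k t"
  with assms have "proportional (pole_vec \<alpha> \<beta> k) (pole_vec \<alpha> \<beta> t)"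
    by (intro annihilator_unique[of _ _ k t]) (simp_all add: scalar_product_pole dual_form_commute)
  with \<open>\<not> proportional k t\<close> assms(1,2) show False
    by (metis polar_pole polar_proportional_iff)
qed

text \<open>That \<open>k\<close> passes through \<open>m\<close> means that \<open>k\<close> is
  orthogonal to the polar of \<open>m\<close>; both are isotropic for the dual form, so they
  agree.\<close>

lemma tangent_at_conic_point:
  assumes "\<alpha> \<noteq> 0" "\<beta> \<noteq> 0" "k \<noteq> 0" "m \<noteq> 0" "scalar_product (polar_vec \<alpha> \<beta> m) m = 0"
    and "scalar_product k m = 0" "dual_form \<alpha> \<beta> k k = 0"
  shows "proportional k (polar_vec \<alpha> \<beta> m)"
proof (rule totally_isotropic_proportional[of \<alpha> \<beta>])
  show "dual_form \<alpha> \<beta> k (polar_vec \<alpha> \<beta> m) = 0"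
    using assms by (subst dual_form_commute) (simp add: dual_form_polar scalar_product_commute)
qed (use assms in \<open>simp_all add: dual_form_polar scalar_product_commute\<close>)

text \<open>The orthogonality conditions put the pole of \<open>k\<close> on both \<open>k\<close>
  and \<open>t\<close>, so it is \<open>m\<close>. Thus \<open>m\<close> is the contact point of the
  tangent \<open>k\<close>.\<close>

lemma conic_point_if_double_tangent:
  assumes "\<alpha> \<noteq> 0" "\<beta> \<noteq> 0" "k \<noteq> 0" "m \<noteq> 0" "t \<noteq> 0" "\<not> proportional k t"
    and "scalar_product k m = 0" "scalar_product t m = 0"
    and "dual_form \<alpha> \<beta> k k = 0" "dual_form \<alpha> \<beta> k t = 0"
  shows "scalar_product (polar_vec \<alpha> \<beta> m) m = 0"
proof -
  have "proportional (pole_vec \<alpha> \<beta> k) m"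
    using assms by (intro annihilator_unique[of _ _ k t]) (simp_all add: scalar_product_pole scalar_product_commute[of m])
  then obtain c where "m = c *s pole_vec \<alpha> \<beta> k"
    by (auto simp: proportional_def)
  then have "scalar_product (polar_vec \<alpha> \<beta> m) m = c\<^sup>2 * dual_form \<alpha> \<beta> k k"
    using assms(1,2)
    by (simp add: scalar_product_3 polar_vec_def pole_vec_def dual_form_def algebra_simps power2_eq_square)
  with assms(9) show ?thesis
    by simp
qed

text \<open>A tangent through two points of the conic would be the polar of each of them, while
  polarity is injective.\<close>

lemma secant_not_tangent:
  assumes "\<alpha> \<noteq> 0" "\<beta> \<noteq> 0" "p \<noteq> 0" "r \<noteq> 0" "l \<noteq> 0" "\<not> proportional p r"
    and "scalar_product (polar_vec \<alpha> \<beta> p) p = 0" "scalar_product (polar_vec \<alpha> \<beta> r) r = 0"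
    and "scalar_product l p = 0" "scalar_product l r = 0"
  shows "dual_form \<alpha> \<beta> l l \<noteq> 0"
proof
  assume "dual_form \<alpha> \<beta> l l = 0"
  with assms have "proportional l (polar_vec \<alpha> \<beta> p)" "proportional l (polar_vec \<alpha> \<beta> r)"
    by (auto intro: tangent_at_conic_point)
  then have "line_of (polar_vec \<alpha> \<beta> p) = line_of (polar_vec \<alpha> \<beta> r)"
    using assms by (metis line_of_eq_iff polar_eq_0_iff)
  then have *: "scalar_product (polar_vec \<alpha> \<beta> p) r = 0"
    using assms by (metis abs_in_line_of polar_eq_0_iff)
  then have "scalar_product p (polar_vec \<alpha> \<beta> r) = 0"
    by (simp add: polar_vec_def scalar_product_3)
  then have "proportional (polar_vec \<alpha> \<beta> p) (polar_vec \<alpha> \<beta> r)"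
    using assms by (intro totally_isotropic_proportional[of \<alpha> \<beta>]) (simp_all add: dual_form_polar scalar_product_commute)
  then have "proportional p r"
    using assms by simp
  with assms show False by simp
qed

section \<open>Reflections, isotropic lines and foci\<close>

text \<open>The degenerate dual conic formed by the lines through \<open>I\<close> or
  \<open>J\<close>; it is \<open>q\<close> evaluated on normal vectors of lines.\<close>

definition metric_form :: "complex^3 \<Rightarrow> complex^3 \<Rightarrow> complex" where
  "metric_form k l = k$1 * l$1 + k$2 * l$2"

text \<open>Both reflections are scaled by \<open>metric_form t t\<close> to avoid division; \<open>mirror\<close> acts on covectors,
  \<open>mirror_point\<close> on points.\<close>

definition mirror :: "complex^3 \<Rightarrow> complex^3 \<Rightarrow> complex^3" where
  "mirror t l = metric_form t t *s l - (2 * metric_form l t) *s t"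

definition mirror_point :: "complex^3 \<Rightarrow> complex^3 \<Rightarrow> complex^3" where
  "mirror_point t p = metric_form t t *s p - (2 * scalar_product t p) *s vector [t$1, t$2, 0]"

lemma mirror_mirror: "mirror t (mirror t l) = (metric_form t t)\<^sup>2 *s l"
  unfolding vec_eq_iff forall_3
  by (simp add: mirror_def metric_form_def) (intro conjI; algebra)

lemma mirror_point_mirror_point: "mirror_point t (mirror_point t p) = (metric_form t t)\<^sup>2 *s p"
  unfolding vec_eq_iff forall_3
  by (simp add: mirror_point_def metric_form_def scalar_product_3) (intro conjI; algebra)

lemma scalar_product_mirror: "scalar_product (mirror t l) p = scalar_product l (mirror_point t p)"
  by (simp add: mirror_def mirror_point_def metric_form_def scalar_product_3 algebra_simps)

lemma mirror_nonzero:
  assumes "metric_form t t \<noteq> 0" "l \<noteq> 0"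
  shows "mirror t l \<noteq> 0"
proof
  assume "mirror t l = 0"
  then have "mirror t (mirror t l) = 0"
    by (simp only:) (simp add: mirror_def metric_form_def)
  then have "(metric_form t t)\<^sup>2 *s l = 0"
    by (simp only: mirror_mirror)
  with assms show False
    by simp
qed

lemma mirror_point_nonzero:
  assumes "metric_form t t \<noteq> 0" "p \<noteq> 0"
  shows "mirror_point t p \<noteq> 0"
proof
  assume "mirror_point t p = 0"
  then have "mirror_point t (mirror_point t p) = 0"
    by (simp only:) (simp add: mirror_point_def scalar_product_3)
  then have "(metric_form t t)\<^sup>2 *s p = 0"
    by (simp only: mirror_point_mirror_point)
  with assms show False
    by simp
qed

section \<open>The affine symmetry in a non-isotropic line\<close>

lemma vector2_eq: "(v :: complex^2) = w \<longleftrightarrow> v$1 = w$1 \<and> v$2 = w$2"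
  by (simp add: vec_eq_iff forall_2)

lemma affine_point_in_line_of:
  "l \<noteq> 0 \<Longrightarrow> affine_point v \<in> line_of l \<longleftrightarrow> l$1 * v$1 + l$2 * v$2 + l$3 = 0"
  unfolding affine_point_def hpoint_def
  by (subst abs_in_line_of) (auto simp: eq_0_iff_3 scalar_product_3)

text \<open>Linear part of \<open>mirror_point t\<close> in affine coordinates, after division by
  \<open>metric_form t t\<close>.\<close>

definition mirror_matrix :: "complex^3 \<Rightarrow> complex^2^2" where
  "mirror_matrix t = vector
     [vector [1 - 2 * (t$1)\<^sup>2 / metric_form t t, - (2 * t$1 * t$2 / metric_form t t)],
      vector [- (2 * t$1 * t$2 / metric_form t t), 1 - 2 * (t$2)\<^sup>2 / metric_form t t]]"

definition mirror_shift :: "complex^3 \<Rightarrow> complex^2" where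
  "mirror_shift t = vector [- (2 * t$3 * t$1 / metric_form t t), - (2 * t$3 * t$2 / metric_form t t)]"

lemma mirror_affine_map:
  assumes "metric_form t t \<noteq> 0"
  shows "affine_map (mirror_matrix t) (mirror_shift t) v =
    v - (2 * (t$1 * v$1 + t$2 * v$2 + t$3) / metric_form t t) *s vector [t$1, t$2]"
  using assms
  by (simp add: vector2_eq affine_map_def mirror_matrix_def mirror_shift_def matrix_vector_mult_def
      sum_2 field_simps power2_eq_square)

lemma affine_symmetry_mirror:
  assumes "metric_form t t \<noteq> 0"
  shows "affine_symmetry (line_of t) (affine_map (mirror_matrix t) (mirror_shift t))"
    (is "affine_symmetry _ ?f")
proof -
  have t: "t \<noteq> 0" "t$1 \<noteq> 0 \<or> t$2 \<noteq> 0"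
    using assms by (auto simp: metric_form_def)
  \<comment> \<open>Twice the component of \<open>v\<close> normal to the line; the reflection
    reverses its sign.\<close>
  define r where "r v = 2 * (t$1 * v$1 + t$2 * v$2 + t$3) / metric_form t t" for v :: "complex^2"
  have f: "?f v = v - r v *s vector [t$1, t$2]" for v
    using assms by (simp add: mirror_affine_map r_def)
  have r: "r v * metric_form t t = 2 * (t$1 * v$1 + t$2 * v$2 + t$3)" for v
    using assms by (simp add: r_def)
  have "?f \<noteq> id"
  proof
    assume "?f = id"
    then have "r v = 0" for v :: "complex^2"
      using t(2) f[of v] by (auto simp: vector2_eq)
    then have "t$1 * v$1 + t$2 * v$2 + t$3 = 0" for v :: "complex^2"
      using r[of v] by (metis mult_zero_left mult_eq_0_iff zero_neq_numeral)
    from this[of "vector [t$1, t$2]"] this[of 0] show False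
      using assms by (simp add: metric_form_def)
  qed
  moreover have "?f (?f v) = v" for v
  proof -
    have "r (?f v) * metric_form t t = - r v * metric_form t t"
      unfolding r f using r[of v] by (simp add: metric_form_def) algebra
    then have "r (?f v) = - r v"
      using assms by (metis mult_cancel_right)
    then show ?thesis
      by (subst f) (simp add: f vector2_eq)
  qed
  moreover have "q (?f u - ?f v) = q (u - v)" for u v
    using r[of u] r[of v] unfolding f q_def metric_form_def
    by simp algebra
  moreover have "?f v = v" if "affine_point v \<in> line_of t" for v
    using that t(1) by (simp add: f r_def affine_point_in_line_of)
  ultimately show ?thesis
    by (auto simp: affine_symmetry_def)
qed

text \<open>A map fixing the line pointwise is determined by the image \<open>(w1, w2)\<close> of
  the normal vector under its linear part. Isometry leaves only the normal and its negative, and the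
  former gives the identity.\<close>

lemma affine_symmetry_unique:
  assumes "metric_form t t \<noteq> 0" "affine_symmetry (line_of t) (affine_map A s)"
  shows "A = mirror_matrix t \<and> s = mirror_shift t"
proof -
  let ?f = "affine_map A s"
  have t: "t \<noteq> 0"
    using assms(1) by (auto simp: metric_form_def)
  define g where "g = metric_form t t"
  have g: "g \<noteq> 0" "g = (t$1)\<^sup>2 + (t$2)\<^sup>2"
    using assms(1) by (simp_all add: g_def metric_form_def power2_eq_square)
  have f: "?f v = vector [A$1$1 * v$1 + A$1$2 * v$2 + s$1, A$2$1 * v$1 + A$2$2 * v$2 + s$2]" for v
    by (simp add: vector2_eq affine_map_def matrix_vector_mult_def sum_2)
  have fixed: "?f v = v" if "t$1 * v$1 + t$2 * v$2 + t$3 = 0" for v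
    using assms(2) that t by (simp add: affine_symmetry_def affine_point_in_line_of)
  have isom: "q (?f u - ?f v) = q (u - v)" for u v
    using assms(2) by (auto simp: affine_symmetry_def)
  define c where "c = t$3 / g"
  have c: "t$3 = c * g"
    using g(1) by (simp add: c_def)
  \<comment> \<open>The foot of the perpendicular from the origin to the line.\<close>
  define v0 where "v0 = (vector [- (c * t$1), - (c * t$2)] :: complex^2)"
  have v0: "t$1 * v0$1 + t$2 * v0$2 + t$3 = 0"
    by (simp add: v0_def c g(2) algebra_simps power2_eq_square)
  have f0: "?f v0 = v0"
    by (rule fixed[OF v0])
  have "?f (v0 + vector [- (t$2), t$1]) = v0 + vector [- (t$2), t$1]"
    by (rule fixed) (use v0 in \<open>simp add: algebra_simps\<close>)
  then have "?f (v0 + vector [- (t$2), t$1]) - ?f v0 = vector [- (t$2), t$1]"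
    by (simp add: f0)
  then have u: "A$1$1 * t$2 = A$1$2 * t$1 + t$2" "A$2$2 * t$1 = A$2$1 * t$2 + t$1"
    unfolding f vector2_eq by (simp_all add: algebra_simps eq_neg_iff_add_eq_0)
  define w1 w2 where "w1 = A$1$1 * t$1 + A$1$2 * t$2" and "w2 = A$2$1 * t$1 + A$2$2 * t$2"
  \<comment> \<open>The normal \<open>(t1, t2)\<close> and the direction \<open>(-t2, t1)\<close>
    form a basis of determinant \<open>g\<close>, and the linear part fixes the direction.\<close>
  have entries: "A$1$1 * g = w1 * t$1 + (t$2)\<^sup>2" "A$1$2 * g = w1 * t$2 - t$1 * t$2"
      "A$2$1 * g = w2 * t$1 - t$1 * t$2" "A$2$2 * g = w2 * t$2 + (t$1)\<^sup>2"
    using u unfolding g(2) w1_def w2_def by algebra+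
  have w: "w1\<^sup>2 + w2\<^sup>2 = g"
    using isom[of "vector [t$1, t$2]" 0] by (simp add: f q_def w1_def w2_def g)
  \<comment> \<open>Polarization: the isometry is applied to the sum of the normal and the
    direction, so that the image of the normal is again orthogonal to the direction.\<close>
  have "(w1 - t$2)\<^sup>2 + (w2 + t$1)\<^sup>2 = 2 * g"
  proof -
    have "q (?f (vector [t$1 - t$2, t$2 + t$1]) - ?f 0) = q (vector [t$1 - t$2, t$2 + t$1])"
      using isom[of "vector [t$1 - t$2, t$2 + t$1]" 0] by simp
    then show ?thesis
      unfolding f q_def w1_def w2_def g(2) using u by simp algebra
  qed
  with w have orth: "w2 * t$1 = w1 * t$2"
    unfolding g(2) by algebra
  have "w1 = - (t$1) \<and> w2 = - (t$2)"
  proof (rule ccontr)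
    assume not: "\<not> (w1 = - (t$1) \<and> w2 = - (t$2))"
    have "w1 = t$1 \<and> w2 = t$2"
    proof -
      have *: "g * w1 = (w1 * t$1 + w2 * t$2) * t$1" "g * w2 = (w1 * t$1 + w2 * t$2) * t$2"
        using orth unfolding g(2) by algebra+
      have "(w1 * t$1 + w2 * t$2)\<^sup>2 = g\<^sup>2"
        using orth w unfolding g(2) by algebra
      then have "w1 * t$1 + w2 * t$2 = g \<or> w1 * t$1 + w2 * t$2 = - g"
        by (simp add: power2_eq_iff)
      then show ?thesis
      proof
        assume "w1 * t$1 + w2 * t$2 = g"
        with * g(1) show ?thesis by simp
      next
        assume "w1 * t$1 + w2 * t$2 = - g"
        with * have "g * w1 = g * - (t$1)" "g * w2 = g * - (t$2)" by simp_all
        with g(1) not show ?thesis by (simp only: mult_cancel_left) simp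
      qed
    qed
    then have "A$1$1 * g = g" "A$1$2 * g = 0" "A$2$1 * g = 0" "A$2$2 * g = g"
      unfolding entries by (simp_all add: g(2) power2_eq_square)
    with g(1) have A: "A$1$1 = 1" "A$1$2 = 0" "A$2$1 = 0" "A$2$2 = 1"
      by simp_all
    with f0 have "?f = id"
      by (auto simp: fun_eq_iff f vector2_eq)
    with assms(2) show False
      by (simp add: affine_symmetry_def)
  qed
  then have eqs: "A$1$1 * g = g - 2 * (t$1)\<^sup>2" "A$1$2 * g = - (2 * t$1 * t$2)"
     "A$2$1 * g = - (2 * t$1 * t$2)" "A$2$2 * g = g - 2 * (t$2)\<^sup>2"
    unfolding entries by (simp_all add: g(2) power2_eq_square)
  then have A: "A$1$1 = 1 - 2 * (t$1)\<^sup>2 / g" "A$1$2 = - (2 * t$1 * t$2 / g)"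
     "A$2$1 = - (2 * t$1 * t$2 / g)" "A$2$2 = 1 - 2 * (t$2)\<^sup>2 / g"
    using g(1) by (simp_all add: field_simps)
  then have A_eq: "A = mirror_matrix t"
    by (simp add: mirror_matrix_def vec_eq_iff forall_2 g_def)
  have "?f v0 = affine_map (mirror_matrix t) (mirror_shift t) v0"
    using v0 f0 assms(1) by (simp add: mirror_affine_map)
  with A_eq show ?thesis
    by (simp add: affine_map_def)
qed

lemma rep_cp2_abs:
  assumes "p \<noteq> 0"
  obtains k where "k \<noteq> 0" "rep_cp2 (abs_cp2 p) = k *s p"
proof -
  have "proportional (rep_cp2 (abs_cp2 p)) (rep_cp2 (abs_cp2 p))"
    by (rule Quotient3_rep_reflp[OF Quotient3_cp2])
  then have "proportional p (rep_cp2 (abs_cp2 p))"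
    using assms abs_cp2_eq_iff[of p "rep_cp2 (abs_cp2 p)"]
    by (simp add: proportional_refl Quotient3_abs_rep[OF Quotient3_cp2])
  with that show ?thesis
    by (auto simp: proportional_def)
qed

lemma symmetry_abs:
  assumes "metric_form t t \<noteq> 0" "p \<noteq> 0"
  shows "symmetry (line_of t) (abs_cp2 p) = abs_cp2 (mirror_point t p)"
proof -
  let ?A = "mirror_matrix t" and ?s = "mirror_shift t"
  have "symmetry (line_of t) = affine_extension ?A ?s"
    unfolding symmetry_def
    using assms affine_symmetry_mirror affine_symmetry_unique by (intro the_equality) blast+
  moreover
  obtain k where k: "k \<noteq> 0" "rep_cp2 (abs_cp2 p) = k *s p"
    using assms(2) by (rule rep_cp2_abs)
  have eq: "mirror_point t p = (metric_form t t / k) *s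
     (vector [vector [?A$1$1, ?A$1$2, ?s$1], vector [?A$2$1, ?A$2$2, ?s$2], vector [0, 0, 1]] *v (k *s p))"
    using assms k
    by (simp add: vec_eq_iff forall_3 matrix_vector_mult_def sum_3 mirror_point_def mirror_matrix_def
         mirror_shift_def scalar_product_3 field_simps power2_eq_square)
  have "affine_extension ?A ?s (abs_cp2 p) = abs_cp2 (mirror_point t p)"
    unfolding affine_extension_def k(2)
    using mirror_point_nonzero[OF assms] assms k
    by (subst abs_cp2_eq_iff) (auto simp: eq proportional_def intro!: exI[of _ "metric_form t t / k"])
  ultimately show ?thesis
    by simp
qed

text \<open>The symmetry is an involution, so the image of a line is its preimage, and
  \<open>mirror\<close> is the adjoint of \<open>mirror_point\<close>.\<close>

lemma symmetry_image_line:
  assumes "metric_form t t \<noteq> 0" "l \<noteq> 0"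
  shows "symmetry (line_of t) ` line_of l = line_of (mirror t l)"
proof -
  let ?s = "symmetry (line_of t)"
  have inv: "?s (?s P) = P" for P
  proof -
    obtain p where p: "p \<noteq> 0" "P = abs_cp2 p" by (rule cp2_cases)
    have "proportional p ((metric_form t t)\<^sup>2 *s p)"
      using p assms unfolding proportional_def by (intro conjI exI[of _ "(metric_form t t)\<^sup>2"]) simp_all
    then have "proportional ((metric_form t t)\<^sup>2 *s p) p"
      by (rule proportional_sym)
    with p assms show ?thesis
      by (simp add: symmetry_abs mirror_point_nonzero mirror_point_mirror_point abs_cp2_eq_iff)
  qed
  have iff: "?s P \<in> line_of l \<longleftrightarrow> P \<in> line_of (mirror t l)" for P
  proof -
    obtain p where "p \<noteq> 0" "P = abs_cp2 p" by (rule cp2_cases)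
    with assms show ?thesis
      by (simp add: symmetry_abs mirror_point_nonzero mirror_nonzero abs_in_line_of scalar_product_mirror)
  qed
  show ?thesis
    using inv iff by (metis (no_types, lifting) image_iff set_eq_iff)
qed

section \<open>Isotropy and foci as conditions on covectors\<close>

lemma isotropic_line_of:
  assumes "l \<noteq> 0"
  shows "isotropic (line_of l) \<longleftrightarrow> metric_form l l = 0"
proof -
  \<comment> \<open>The two factors are the values of \<open>l\<close> at \<open>I\<close> and
    \<open>J\<close>.\<close>
  have "metric_form l l = (l$1 + \<i> * l$2) * (l$1 - \<i> * l$2)"
    by (simp add: metric_form_def algebra_simps)
  moreover have "(vector [1, \<i>, 0] :: complex^3) \<noteq> 0" "(vector [1, - \<i>, 0] :: complex^3) \<noteq> 0"
    by (simp_all add: eq_0_iff_3)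
  ultimately show ?thesis
    using assms by (simp add: isotropic_def hpoint_def abs_in_line_of scalar_product_3 mult.commute disj_commute)
qed

text \<open>The foci are the degenerate members of the confocal family: subtracting \<open>A\<close>
  or \<open>B\<close> times the metric form makes the dual form split into the values of
  \<open>l\<close> at the two complex or the two real foci, up to sign.\<close>

lemma line_of_disjoint_foci:
  assumes "l \<noteq> 0" "0 < b" "b < a"
  defines "A \<equiv> (complex_of_real a)\<^sup>2" and "B \<equiv> (complex_of_real b)\<^sup>2"
  shows "line_of l \<inter> foci a b = {} \<longleftrightarrow>
    dual_form A B l l \<noteq> A * metric_form l l \<and> dual_form A B l l \<noteq> B * metric_form l l"
proof -
  define c where "c = complex_of_real (sqrt (a\<^sup>2 - b\<^sup>2))"
  have "b\<^sup>2 \<le> a\<^sup>2"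
    using assms by (intro power_mono) auto
  then have "(sqrt (a\<^sup>2 - b\<^sup>2))\<^sup>2 = a\<^sup>2 - b\<^sup>2"
    by simp
  then have "c\<^sup>2 = A - B"
    unfolding c_def A_def B_def by (metis of_real_diff of_real_power)
  then have c: "A = B + c\<^sup>2"
    by simp
  have nz: "(vector [x, y, 1] :: complex^3) \<noteq> 0" for x y
    by (simp add: eq_0_iff_3)
  have in_line: "hpoint x y 1 \<in> line_of l \<longleftrightarrow> l$1 * x + l$2 * y + l$3 = 0" for x y
    using assms(1) nz by (simp add: hpoint_def abs_in_line_of scalar_product_3)
  have A: "dual_form A B l l - A * metric_form l l = - ((l$2 * (\<i> * c) + l$3) * (l$2 * (- \<i> * c) + l$3))"
    unfolding c by (simp add: dual_form_def metric_form_def algebra_simps power2_eq_square)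
  have B: "dual_form A B l l - B * metric_form l l = - ((l$1 * c + l$3) * (l$1 * (- c) + l$3))"
    unfolding c by (simp add: dual_form_def metric_form_def algebra_simps power2_eq_square)
  have "dual_form A B l l = A * metric_form l l \<longleftrightarrow>
      hpoint 0 (\<i> * c) 1 \<in> line_of l \<or> hpoint 0 (- \<i> * c) 1 \<in> line_of l"
    using A unfolding in_line right_minus_eq[symmetric, of "dual_form A B l l"] by simp
  moreover have "dual_form A B l l = B * metric_form l l \<longleftrightarrow>
      hpoint c 0 1 \<in> line_of l \<or> hpoint (- c) 0 1 \<in> line_of l"
    using B unfolding in_line right_minus_eq[symmetric, of "dual_form A B l l"] by simp
  ultimately show ?thesis
    unfolding foci_def Let_def c_def[symmetric] by blast
qed

section \<open>Confocal tangents at a vertex\<close>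

lemma dual_form_confocal:
  "dual_form (A + \<mu>) (B + \<mu>) k l = dual_form A B k l + \<mu> * metric_form k l"
  by (simp add: dual_form_def metric_form_def algebra_simps)

text \<open>Adding a multiple of \<open>t\<close> to \<open>l\<close> does not change the dual form
  of the ellipse, so only the factor \<open>metric_form t t\<close> acts on it; the metric form is
  scaled equally because \<open>mirror\<close> is a multiple of a reflection.\<close>

lemma dual_form_mirror:
  assumes "dual_form A B t t = 0" "dual_form A B l t = 0"
  shows "dual_form (A + \<mu>) (B + \<mu>) (mirror t l) (mirror t l) =
    (metric_form t t)\<^sup>2 * dual_form (A + \<mu>) (B + \<mu>) l l"
  using assms unfolding dual_form_confocal
  by (simp add: dual_form_def metric_form_def mirror_def) algebra

lemma dual_form_eq_0_line_cong:
  assumes "line_of k = line_of l" "k \<noteq> 0" "l \<noteq> 0"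
  shows "dual_form \<alpha> \<beta> k k = 0 \<longleftrightarrow> dual_form \<alpha> \<beta> l l = 0"
proof -
  obtain c where "c \<noteq> 0" "l = c *s k"
    using assms by (auto simp: line_of_eq_iff proportional_def)
  moreover have "dual_form \<alpha> \<beta> (c *s k) (c *s k) = c\<^sup>2 * dual_form \<alpha> \<beta> k k"
    by (simp add: dual_form_def algebra_simps power2_eq_square)
  ultimately show ?thesis
    by simp
qed

text \<open>The situation at one vertex, with incoming side \<open>l\<close> and outgoing side
  \<open>k\<close>. The right-hand side separates a scalar equation for \<open>\<mu>\<close> from a
  reflection law independent of \<open>\<mu>\<close>.\<close>

lemma realize_tangents_iff:
  assumes "A \<noteq> 0" "B \<noteq> 0" "A + \<mu> \<noteq> 0" "B + \<mu> \<noteq> 0" "m \<noteq> 0" "l \<noteq> 0"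
    and m: "scalar_product (polar_vec A B m) m = 0"
    and l: "scalar_product l m = 0"
    and secant: "dual_form A B l l \<noteq> 0" "dual_form A B k k \<noteq> 0"
    and k: "k \<noteq> 0"
  defines "t \<equiv> polar_vec A B m"
  shows "realize_tangents (central_conic (A + \<mu>) (B + \<mu>)) (abs_cp2 m) (line_of l) (line_of k) \<longleftrightarrow>
    dual_form (A + \<mu>) (B + \<mu>) l l = 0 \<and> metric_form t t \<noteq> 0 \<and> line_of k = line_of (mirror t l)"
    (is "realize_tangents ?S ?M ?L ?K \<longleftrightarrow> _")
proof -
  define \<Phi> where "\<Phi> = dual_form (A + \<mu>) (B + \<mu>)"
  define tangents where "tangents = {n. n \<noteq> 0 \<and> scalar_product n m = 0 \<and> \<Phi> n n = 0}"
  have tangents: "tangents_through ?S ?M = line_of ` tangents"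
    using assms by (simp add: tangents_through_eq tangents_def \<Phi>_def)
  have "dual_form A B t l = 0"
    using assms by (simp add: t_def dual_form_polar scalar_product_commute)
  then have t: "t \<noteq> 0" "scalar_product t m = 0" "dual_form A B t t = 0" "dual_form A B l t = 0"
    using assms by (simp_all add: t_def dual_form_polar scalar_product_commute dual_form_commute)
  have "\<not> proportional l t"
    using dual_form_eq_0_line_cong[of l t A B] t(1,3) secant(1) \<open>l \<noteq> 0\<close> by (auto simp: line_of_eq_iff)
  have \<Phi>_t: "\<Phi> t t = \<mu> * metric_form t t" "\<Phi> l t = \<mu> * metric_form l t"
    using t by (simp_all add: \<Phi>_def dual_form_confocal)
  have on_conic: "?M \<in> conic_points ?S \<longleftrightarrow> scalar_product (polar_vec (A + \<mu>) (B + \<mu>) m) m = 0"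
    using assms by (simp add: abs_in_conic_points)
  have tangent_m: "tangent_line ?S ?M = line_of (polar_vec (A + \<mu>) (B + \<mu>) m)"
    using assms by (simp add: tangent_line_eq)
  have on_conic_tangents: "line_of ` tangents = {tangent_line ?S ?M}" if "?M \<in> conic_points ?S"
  proof -
    have "polar_vec (A + \<mu>) (B + \<mu>) m \<in> tangents"
      using that assms by (simp add: on_conic tangents_def \<Phi>_def dual_form_polar scalar_product_commute)
    moreover have "line_of n = tangent_line ?S ?M" if "n \<in> tangents" for n
      using that \<open>?M \<in> conic_points ?S\<close> assms
      by (auto simp: on_conic tangents_def \<Phi>_def tangent_m line_of_eq_iff intro!: tangent_at_conic_point)
    ultimately show ?thesis
      using tangent_m by blast
  qed
  \<comment> \<open>On the conic the pencil has a single tangent, so both branches of the definition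
    merge into one equation of sets together with a criterion for coincidence.\<close>
  have realize: "realize_tangents ?S ?M ?L ?K \<longleftrightarrow>
      {?L, ?K} = line_of ` tangents \<and> (?L = ?K \<longleftrightarrow> ?M \<in> conic_points ?S)"
    using on_conic_tangents by (auto simp: realize_tangents_def tangents)
  have \<Phi>_l: "\<Phi> l l = 0" if "?L \<in> line_of ` tangents"
  proof -
    from that obtain n where "?L = line_of n" "n \<noteq> 0" "\<Phi> n n = 0"
      by (auto simp: tangents_def)
    with \<open>l \<noteq> 0\<close> show ?thesis
      using dual_form_eq_0_line_cong unfolding \<Phi>_def by blast
  qed
  \<comment> \<open>An isotropic \<open>t\<close> would touch the confocal conic too and hence be a
    side; but \<open>t\<close> touches the ellipse and the sides do not.\<close>
  have nonisotropic: "metric_form t t \<noteq> 0" if "{?L, ?K} = line_of ` tangents"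
  proof
    assume "metric_form t t = 0"
    then have "t \<in> tangents"
      using t \<Phi>_t by (simp add: tangents_def)
    then have "line_of t = ?L \<or> line_of t = ?K"
      using that by blast
    then show False
      using secant t(1,3) \<open>l \<noteq> 0\<close> k by (metis dual_form_eq_0_line_cong)
  qed
  have mirror: "line_of ` tangents = {?L, line_of (mirror t l)}"
      "?L = line_of (mirror t l) \<longleftrightarrow> ?M \<in> conic_points ?S"
    if "\<Phi> l l = 0" "metric_form t t \<noteq> 0"
  proof -
    have "\<mu> \<noteq> 0"
      using that(1) secant(1) by (auto simp: \<Phi>_def dual_form_confocal)
    have nz: "mirror t l \<noteq> 0"
      using that(2) \<open>l \<noteq> 0\<close> by (rule mirror_nonzero)
    have "l \<in> tangents"
      using that \<open>l \<noteq> 0\<close> l by (simp add: tangents_def)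
    moreover have "scalar_product (mirror t l) m =
        metric_form t t * scalar_product l m - 2 * metric_form l t * scalar_product t m"
      by (simp add: mirror_def scalar_product_3 algebra_simps)
    then have "mirror t l \<in> tangents"
      using that t l nz by (simp add: tangents_def \<Phi>_def dual_form_mirror)
    moreover have "line_of n = ?L \<or> line_of n = line_of (mirror t l)" if "n \<in> tangents" for n
    proof -
      have n: "n \<noteq> 0" "scalar_product n m = 0" "\<Phi> n n = 0"
        using that by (simp_all add: tangents_def)
      obtain x y where xy: "n = x *s l + y *s t"
        using pencil_combination[of m l t n] \<open>m \<noteq> 0\<close> \<open>l \<noteq> 0\<close> t l n(2) \<open>\<not> proportional l t\<close> by blast
      \<comment> \<open>The coefficient of \<open>x\<close> squared vanishes, so the form factors:
        the root \<open>y = 0\<close> is \<open>l\<close>, the other root is its mirror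
        image.\<close>
      have "\<Phi> n n = x\<^sup>2 * \<Phi> l l + 2 * x * y * \<Phi> l t + y\<^sup>2 * \<Phi> t t"
        by (simp add: xy \<Phi>_def dual_form_def algebra_simps power2_eq_square)
      also have "\<dots> = \<mu> * y * (2 * x * metric_form l t + y * metric_form t t)"
        unfolding \<Phi>_t \<open>\<Phi> l l = 0\<close> by (simp add: algebra_simps power2_eq_square)
      finally have "y = 0 \<or> y * metric_form t t = - (2 * x * metric_form l t)"
        using n(3) \<open>\<mu> \<noteq> 0\<close> by (auto simp: eq_neg_iff_add_eq_0 add.commute)
      then show ?thesis
      proof
        assume "y = 0"
        then have "proportional l n"
          using xy n(1) by (auto simp: proportional_def)
        with \<open>l \<noteq> 0\<close> n(1) show ?thesis
          by (auto simp: line_of_eq_iff intro: proportional_sym)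
      next
        assume y: "y * metric_form t t = - (2 * x * metric_form l t)"
        then have y: "y = - (2 * x * metric_form l t) / metric_form t t"
          using \<open>metric_form t t \<noteq> 0\<close> by (metis nonzero_eq_divide_eq)
        have "n = (x / metric_form t t) *s mirror t l"
          using \<open>metric_form t t \<noteq> 0\<close> unfolding xy mirror_def y by (simp add: vec_eq_iff field_simps)
        then have "proportional (mirror t l) n"
          using n(1) nz by (auto simp: proportional_def)
        with nz n(1) show ?thesis
          by (auto simp: line_of_eq_iff intro: proportional_sym)
      qed
    qed
    ultimately show eq: "line_of ` tangents = {?L, line_of (mirror t l)}"
      by blast
    show "?L = line_of (mirror t l) \<longleftrightarrow> ?M \<in> conic_points ?S"
    proof
      assume "?M \<in> conic_points ?S"
      then show "?L = line_of (mirror t l)"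
        using on_conic_tangents eq by (metis insertI1 insertI2 singletonD)
    next
      \<comment> \<open>A line equal to its mirror image, yet different from \<open>t\<close>, is
        metrically orthogonal to \<open>t\<close>; it is then a double tangent.\<close>
      assume "?L = line_of (mirror t l)"
      then have "wedge l (mirror t l) = 0"
        using \<open>l \<noteq> 0\<close> nz by (simp add: line_of_eq_iff proportional_iff_wedge)
      moreover have "wedge l (mirror t l) = (- 2 * metric_form l t) *s wedge l t"
        by (simp add: wedge_def mirror_def vec_eq_iff forall_3 algebra_simps)
      ultimately have "metric_form l t = 0"
        using \<open>\<not> proportional l t\<close> \<open>l \<noteq> 0\<close> t(1) by (auto simp: proportional_iff_wedge)
      then show "?M \<in> conic_points ?S"
        unfolding on_conic using assms t \<Phi>_t(2) \<open>\<not> proportional l t\<close> that(1)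
        by (intro conic_point_if_double_tangent[of _ _ l m t]) (simp_all add: \<Phi>_def)
    qed
  qed
  show ?thesis
    unfolding realize \<Phi>_def[symmetric]
  proof
    assume *: "{?L, ?K} = line_of ` tangents \<and> (?L = ?K \<longleftrightarrow> ?M \<in> conic_points ?S)"
    then have "\<Phi> l l = 0" "metric_form t t \<noteq> 0"
      using \<Phi>_l nonisotropic by blast+
    moreover from * mirror(1)[OF this] have "?K = line_of (mirror t l)"
      by (simp add: doubleton_eq_iff) blast
    ultimately show "\<Phi> l l = 0 \<and> metric_form t t \<noteq> 0 \<and> ?K = line_of (mirror t l)"
      by simp
  next
    assume "\<Phi> l l = 0 \<and> metric_form t t \<noteq> 0 \<and> ?K = line_of (mirror t l)"
    with mirror show "{?L, ?K} = line_of ` tangents \<and> (?L = ?K \<longleftrightarrow> ?M \<in> conic_points ?S)"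
      by simp
  qed
qed

section \<open>From single vertices to the whole trajectory\<close>

theorem theorem1p2:
  fixes a b :: real and n :: nat and M :: "nat \<Rightarrow> cp2"
  assumes "0 < b" and "b < a"
    and "2 \<le> n"
    and "\<forall>j\<le>n. M j \<in> conic_points (ellipse a b)"
    and "\<forall>j<n. M j \<noteq> M (Suc j)"
  shows "((\<exists>l. (of_real a)\<^sup>2 + l \<noteq> 0 \<and> (of_real b)\<^sup>2 + l \<noteq> 0 \<and> sides_tangent (confocal a b l) n M) \<longleftrightarrow>
           (billiard_piece (ellipse a b) n M \<and> non_isotropic_piece n M \<and>
            (\<forall>j<n. side M j \<inter> foci a b = {}))) \<and>
         (\<forall>l l'.
            (of_real a)\<^sup>2 + l \<noteq> 0 \<and> (of_real b)\<^sup>2 + l \<noteq> 0 \<and> sides_tangent (confocal a b l) n M \<longrightarrow>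
            (of_real a)\<^sup>2 + l' \<noteq> 0 \<and> (of_real b)\<^sup>2 + l' \<noteq> 0 \<and> sides_tangent (confocal a b l') n M \<longrightarrow>
            l = l')"
proof -
  define A B where "A = (complex_of_real a)\<^sup>2" and "B = (complex_of_real b)\<^sup>2"
  have AB: "A \<noteq> 0" "B \<noteq> 0"
    using assms(1,2) by (simp_all add: A_def B_def)
  have "\<forall>j. \<exists>v. v \<noteq> 0 \<and> M j = abs_cp2 v"
    by (metis cp2_cases)
  then obtain m where m: "m j \<noteq> 0" "M j = abs_cp2 (m j)" for j
    by metis
  define t where "t j = polar_vec A B (m j)" for j
  have t: "t j \<noteq> 0" "tangent_line (ellipse a b) (M j) = line_of (t j)" for j
    using AB m by (simp_all add: t_def ellipse_def tangent_line_eq flip: A_def B_def)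
  have on_ellipse: "scalar_product (t j) (m j) = 0" if "j \<le> n" for j
    using assms(4) that AB m by (simp add: t_def ellipse_def abs_in_conic_points flip: A_def B_def)
  define l where "l j = wedge (m j) (m (Suc j))" for j
  have "\<not> proportional (m j) (m (Suc j))" if "j < n" for j
    using assms(5) that m by (simp add: abs_cp2_eq_iff)
  then have l: "l j \<noteq> 0" "side M j = line_of (l j)" "dual_form A B (l j) (l j) \<noteq> 0" if "j < n" for j
    using that m AB on_ellipse[of j] on_ellipse[of "Suc j"]
      secant_not_tangent[of A B "m j" "m (Suc j)" "l j"]
    by (simp_all add: l_def side_def line_through_eq proportional_iff_wedge t_def)
  have l_m: "scalar_product (l j) (m j) = 0" "scalar_product (l j) (m (Suc j)) = 0" for j
    by (simp_all add: l_def)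
  \<comment> \<open>Free of the parameter and common to both statements; what remains to compare is
    the scalar tangency equation on the sides.\<close>
  define reflected where "reflected j \<longleftrightarrow> metric_form (t j) (t j) \<noteq> 0 \<and>
    line_of (l j) = line_of (mirror (t j) (l (j - 1)))" for j
  have sides_tangent: "sides_tangent (confocal a b \<mu>) n M \<longleftrightarrow>
      (\<forall>j\<in>{1..<n}. dual_form (A + \<mu>) (B + \<mu>) (l (j - 1)) (l (j - 1)) = 0 \<and> reflected j)"
    if "A + \<mu> \<noteq> 0" "B + \<mu> \<noteq> 0" for \<mu>
    unfolding sides_tangent_def
  proof (rule ball_cong[OF refl])
    fix j assume "j \<in> {1..<n}"
    then have j: "j - 1 < n" "j < n" "Suc (j - 1) = j"
      by auto
    have "scalar_product (l (j - 1)) (m j) = 0"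
      using l_m(2)[of "j - 1"] j(3) by simp
    then show "realize_tangents (confocal a b \<mu>) (M j) (side M (j - 1)) (side M j) \<longleftrightarrow>
        dual_form (A + \<mu>) (B + \<mu>) (l (j - 1)) (l (j - 1)) = 0 \<and> reflected j"
      unfolding l(2)[OF j(1)] l(2)[OF j(2)] confocal_def reflected_def t_def m(2)[of j] A_def[symmetric] B_def[symmetric]
      using j l m AB that on_ellipse[of j]
      by (intro realize_tangents_iff) (simp_all add: t_def)
  qed
  have billiard: "billiard_piece (ellipse a b) n M \<longleftrightarrow> (\<forall>j\<in>{1..<n}. reflected j)"
  proof -
    have "\<not> isotropic (tangent_line (ellipse a b) (M j)) \<and>
        symmetric_lines (tangent_line (ellipse a b) (M j)) (side M (j - 1)) (side M j) \<longleftrightarrow>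
        reflected j" if "j \<in> {1..<n}" for j
    proof -
      have "j - 1 < n" "j < n"
        using that by auto
      then show ?thesis
        unfolding symmetric_lines_def reflected_def t(2) l(2)[OF \<open>j - 1 < n\<close>] l(2)[OF \<open>j < n\<close>]
          isotropic_line_of[OF t(1)]
        using symmetry_image_line[of "t j" "l (j - 1)"] l(1)[of "j - 1"] by metis
    qed
    then show ?thesis
      using assms(4,5) by (auto simp: billiard_piece_def)
  qed
  \<comment> \<open>Tangency to a confocal conic passes from a side to the next one by
    reflection.\<close>
  have dual_form_step: "dual_form (A + \<mu>) (B + \<mu>) (l j) (l j) = 0"
    if "j \<in> {1..<n}" "reflected j" "dual_form (A + \<mu>) (B + \<mu>) (l (j - 1)) (l (j - 1)) = 0" for j \<mu>
  proof -
    have j: "j - 1 < n" "j < n" "j \<le> n" "Suc (j - 1) = j"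
      using that(1) by auto
    have "dual_form A B (l (j - 1)) (t j) = 0" "dual_form A B (t j) (t j) = 0"
      using AB l_m(2)[of "j - 1"] j(4) on_ellipse[OF j(3)]
      by (simp_all add: t_def dual_form_polar scalar_product_commute dual_form_commute[of _ _ "l _"])
    then have "dual_form (A + \<mu>) (B + \<mu>) (mirror (t j) (l (j - 1))) (mirror (t j) (l (j - 1))) = 0"
      using that(3) by (simp add: dual_form_mirror)
    moreover have "mirror (t j) (l (j - 1)) \<noteq> 0"
      using that(2) l(1)[OF j(1)] by (simp add: reflected_def mirror_nonzero)
    ultimately show ?thesis
      using that(2) l(1)[OF j(2)] unfolding reflected_def by (metis dual_form_eq_0_line_cong)
  qed
  \<comment> \<open>The vertex conditions give the equation for incoming sides only; the last side
    receives it from its predecessor, which exists since \<open>2 \<le> n\<close>.\<close>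
  have tangent_side: "dual_form (A + \<mu>) (B + \<mu>) (l j) (l j) = 0"
    if "A + \<mu> \<noteq> 0" "B + \<mu> \<noteq> 0" "sides_tangent (confocal a b \<mu>) n M" "j < n" for \<mu> j
  proof -
    have tangent: "\<forall>j\<in>{1..<n}. dual_form (A + \<mu>) (B + \<mu>) (l (j - 1)) (l (j - 1)) = 0 \<and> reflected j"
      using that sides_tangent by blast
    show ?thesis
    proof (cases "Suc j < n")
      case True
      then have "Suc j \<in> {1..<n}"
        by simp
      then show ?thesis
        using tangent by fastforce
    next
      case False
      then have "j \<in> {1..<n}"
        using \<open>2 \<le> n\<close> that(4) by auto
      then show ?thesis
        using tangent dual_form_step by blast
    qed
  qed
  have side_cond: "\<not> isotropic (side M j) \<and> side M j \<inter> foci a b = {} \<longleftrightarrow>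
      metric_form (l j) (l j) \<noteq> 0 \<and> dual_form A B (l j) (l j) \<noteq> A * metric_form (l j) (l j) \<and>
      dual_form A B (l j) (l j) \<noteq> B * metric_form (l j) (l j)" if "j < n" for j
    using l[OF that] assms(1,2) by (simp add: isotropic_line_of line_of_disjoint_foci A_def B_def)
  \<comment> \<open>A side is not tangent to the ellipse, so a vanishing metric form would
    contradict the tangency equation. Any single side thus determines \<open>\<mu>\<close>.\<close>
  have parameter: "metric_form (l j) (l j) \<noteq> 0 \<and> dual_form A B (l j) (l j) = - \<mu> * metric_form (l j) (l j)"
    if "dual_form (A + \<mu>) (B + \<mu>) (l j) (l j) = 0" "j < n" for \<mu> j
    using that(1) l(3)[OF that(2)]
    by (auto simp: dual_form_confocal add_eq_0_iff2)
  have "billiard_piece (ellipse a b) n M \<and> non_isotropic_piece n M \<and> (\<forall>j<n. side M j \<inter> foci a b = {})"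
    if "A + \<mu> \<noteq> 0" "B + \<mu> \<noteq> 0" "sides_tangent (confocal a b \<mu>) n M" for \<mu>
  proof -
    have "billiard_piece (ellipse a b) n M"
      using that by (simp add: billiard sides_tangent)
    moreover have "\<not> isotropic (side M j) \<and> side M j \<inter> foci a b = {}" if "j < n" for j
    proof -
      have F: "dual_form (A + \<mu>) (B + \<mu>) (l j) (l j) = 0"
        using \<open>A + \<mu> \<noteq> 0\<close> \<open>B + \<mu> \<noteq> 0\<close> \<open>sides_tangent _ n M\<close> that by (rule tangent_side)
      then have "metric_form (l j) (l j) \<noteq> 0" "dual_form A B (l j) (l j) = - \<mu> * metric_form (l j) (l j)"
        using parameter that by blast+
      then show ?thesis
        \<comment> \<open>A focus on the side would give
          \<open>(A + \<mu>) * metric_form (l j) (l j) = 0\<close> or the same with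
          \<open>B\<close>.\<close>
        using side_cond[OF that] \<open>A + \<mu> \<noteq> 0\<close> \<open>B + \<mu> \<noteq> 0\<close> by (simp add: neg_eq_iff_add_eq_0 add.commute flip: distrib_right)
    qed
    ultimately show ?thesis
      by (simp add: non_isotropic_piece_def)
  qed
  moreover have "\<exists>\<mu>. A + \<mu> \<noteq> 0 \<and> B + \<mu> \<noteq> 0 \<and> sides_tangent (confocal a b \<mu>) n M"
    if "billiard_piece (ellipse a b) n M" "non_isotropic_piece n M" "\<forall>j<n. side M j \<inter> foci a b = {}"
  proof -
    \<comment> \<open>The only parameter for which the first side can be tangent; that this side
      avoids the foci makes the conic non-degenerate.\<close>
    define \<mu> where "\<mu> = - dual_form A B (l 0) (l 0) / metric_form (l 0) (l 0)"
    have side: "metric_form (l 0) (l 0) \<noteq> 0" "dual_form A B (l 0) (l 0) \<noteq> A * metric_form (l 0) (l 0)"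
        "dual_form A B (l 0) (l 0) \<noteq> B * metric_form (l 0) (l 0)"
      using side_cond[of 0] that(2,3) \<open>2 \<le> n\<close> by (auto simp: non_isotropic_piece_def)
    then have \<mu>: "A + \<mu> \<noteq> 0" "B + \<mu> \<noteq> 0"
      by (auto simp: \<mu>_def field_simps)
    have reflected: "reflected j" if "j \<in> {1..<n}" for j
      using that \<open>billiard_piece (ellipse a b) n M\<close> billiard by blast
    have "dual_form (A + \<mu>) (B + \<mu>) (l j) (l j) = 0" if "j < n" for j
      using that
    proof (induction j)
      case 0
      show ?case
        using side(1) unfolding dual_form_confocal by (simp add: \<mu>_def)
    next
      case (Suc j)
      then have "dual_form (A + \<mu>) (B + \<mu>) (l (Suc j - 1)) (l (Suc j - 1)) = 0" "Suc j \<in> {1..<n}"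
        by simp_all
      then show ?case
        using reflected dual_form_step by blast
    qed
    then have "sides_tangent (confocal a b \<mu>) n M"
      using reflected by (auto simp: sides_tangent[OF \<mu>])
    with \<mu> show ?thesis
      by blast
  qed
  moreover have "\<mu> = \<mu>'"
    if "A + \<mu> \<noteq> 0" "B + \<mu> \<noteq> 0" "sides_tangent (confocal a b \<mu>) n M"
      "A + \<mu>' \<noteq> 0" "B + \<mu>' \<noteq> 0" "sides_tangent (confocal a b \<mu>') n M" for \<mu> \<mu>'
  proof -
    have "0 < n"
      using \<open>2 \<le> n\<close> by simp
    then show ?thesis
      using parameter[OF tangent_side[OF that(1-3)]] parameter[OF tangent_side[OF that(4-6)]]
      by (metis mult_cancel_right neg_equal_iff_equal)
  qed
  ultimately show ?thesis
    unfolding A_def[symmetric] B_def[symmetric] by blast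
qed

end
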